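(* Let $B\geq 2$, let $a\geq 0$ be an integer and $|q|<1$. Then $$\sum_{n=1}^{\infty}\widehat{c}_B(\{a\}^n) q^n=\frac{q}{1-q}\sum_{n=0}^{\infty} \widehat{c}_B(an,a)q^n.$$
   Context: For an integer $a\geq 0$, $s_B(a)$ is the sum of its base-$B$ digits ($s_B(0)=0$). For integers $a_1,\dots,a_r\ge 0$ with base-$B$ digits $a_i=\sum_{j\ge0}\alpha_{i,j}B^j$, $0\le\alpha_{i,j}<B$, let $t\ge0$ be the largest $j$ with some $\alpha_{i,j}\ne0$ ($t=0$ if all are zero), define the carries of the traditional base-$B$ column addition algorithm by $\delta_0=\lfloor(\sum_i\alpha_{i,0})/B\rfloor$, $\delta_j=\lfloor(\sum_i\alpha_{i,j}+\delta_{j-1})/B\rfloor$ for $1\le j\le t$, carry sum $c_B(a_1,\dots,a_r)=\sum_{j=0}^t\delta_j$, terminal carry $\beta=\delta_t$, and $\widehat{c}_B(a_1,\dots,a_r):=\beta-s_B(\beta)+(B-1)c_B(a_1,\dots,a_r)$. In particular for two summands $\widehat{c}_B(a,b)=(B-1)c_B(a,b)$. Finally $\widehat{c}_B(\{a\}^n)$ denotes $\widehat{c}_B(a,a,\dots,a)$ with $n$ copies of $a$. *)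

theory Defs
  imports Complex_Main
begin

definition digit :: "nat \<Rightarrow> nat \<Rightarrow> nat \<Rightarrow> nat" where
  "digit B a j = a div B ^ j mod B"

lemma finite_nonzero_digits:
  assumes "B \<ge> 2"
  shows "finite {j. digit B a j \<noteq> 0}"
proof (rule finite_subset)
  show "{j. digit B a j \<noteq> 0} \<subseteq> {..a}"
  proof
    fix j assume j: "j \<in> {j. digit B a j \<noteq> 0}"
    have "j < B ^ j"
      using assms by (intro power_gt_expt) auto
    then show "j \<in> {..a}"
      using j by (cases "a < B ^ j") (auto simp: digit_def)
  qed
qed simp

definition digit_sum :: "nat \<Rightarrow> nat \<Rightarrow> nat" where
  "digit_sum B a = (\<Sum>j\<in>{j. digit B a j \<noteq> 0}. digit B a j)"

definition top_position :: "nat \<Rightarrow> nat list \<Rightarrow> nat" where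
  "top_position B as =
     (if \<forall>a\<in>set as. a = 0 then 0 else Max {j. \<exists>a\<in>set as. digit B a j \<noteq> 0})"

primrec carry :: "nat \<Rightarrow> nat list \<Rightarrow> nat \<Rightarrow> nat" where
  "carry B as 0 = (\<Sum>a\<leftarrow>as. digit B a 0) div B"
| "carry B as (Suc j) = ((\<Sum>a\<leftarrow>as. digit B a (Suc j)) + carry B as j) div B"

definition carry_sum :: "nat \<Rightarrow> nat list \<Rightarrow> nat" where
  "carry_sum B as = (\<Sum>j=0..top_position B as. carry B as j)"

definition terminal_carry :: "nat \<Rightarrow> nat list \<Rightarrow> nat" where
  "terminal_carry B as = carry B as (top_position B as)"

definition c_hat :: "nat \<Rightarrow> nat list \<Rightarrow> int" where
  "c_hat B as =
     int (terminal_carry B as) - int (digit_sum B (terminal_carry B as))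
       + (int B - 1) * int (carry_sum B as)"

end

theory Submission
  imports Defs
begin

text \<open>Summing the column relations of the addition algorithm yields the generalised Legendre formula
  \<open>c_hat(a\<^sub>1,\<dots>,a\<^sub>r) = s(a\<^sub>1) + \<dots> + s(a\<^sub>r) - s(a\<^sub>1 + \<dots> + a\<^sub>r)\<close> for the digit sum \<open>s\<close>.
  Hence \<open>c_hat(an, a)\<close> is the difference of \<open>c_hat({a}\<^sup>n\<^sup>+\<^sup>1)\<close> and \<open>c_hat({a}\<^sup>n)\<close>, and the
  identity of generating functions is multiplication by \<open>1 - q\<close>.\<close>

section \<open>Digits and digit sums\<close>

lemma digit_eq_0: "a < B ^ j \<Longrightarrow> digit B a j = 0"
  by (simp add: digit_def)

lemma digit_add: "digit B a (k + j) = digit B (a div B ^ k) j"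
  by (simp add: digit_def power_add div_mult2_eq)

lemma digit_decomp: "a div B ^ j = digit B a j + B * (a div B ^ Suc j)"
  unfolding digit_def power_Suc2 div_mult2_eq by simp

lemma less_self_power: "B \<ge> 2 \<Longrightarrow> a < B ^ a" for a B :: nat
  by (intro power_gt_expt) auto

text \<open>Any \<open>M\<close> large enough will do, so digit sums of different numbers can be
  taken over a common range of columns.\<close>

lemma digit_sum_eq_sum:
  assumes "B \<ge> 2" and "a < B ^ M"
  shows "digit_sum B a = (\<Sum>j<M. digit B a j)"
  unfolding digit_sum_def
proof (rule sum.mono_neutral_left)
  show "{j. digit B a j \<noteq> 0} \<subseteq> {..<M}"
  proof
    fix j assume j: "j \<in> {j. digit B a j \<noteq> 0}"
    show "j \<in> {..<M}"
    proof (rule ccontr)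
      assume "j \<notin> {..<M}"
      then have "B ^ M \<le> B ^ j"
        using assms(1) by (intro power_increasing) auto
      with assms(2) j show False
        by (auto simp: digit_eq_0)
    qed
  qed
qed auto

lemma sum_lessThan_plus: "(\<Sum>j<m + n. f j) = (\<Sum>j<m. f j) + (\<Sum>j<n. f (m + j))"
  for f :: "nat \<Rightarrow> nat"
  by (induction n) simp_all

lemma digit_sum_split:
  assumes "B \<ge> 2"
  shows "digit_sum B a = (\<Sum>j<K. digit B a j) + digit_sum B (a div B ^ K)"
proof -
  have 1: "a < B ^ a" by (rule less_self_power[OF assms])
  also have "B ^ a \<le> B ^ (K + a)"
    using assms by (intro power_increasing) auto
  finally have 2: "a < B ^ (K + a)" .
  have "a div B ^ K < B ^ a"
    using 1 div_le_dividend le_less_trans by blast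
  then have 3: "digit_sum B (a div B ^ K) = (\<Sum>j<a. digit B a (K + j))"
    by (simp add: digit_sum_eq_sum[OF assms] digit_add)
  have "digit_sum B a = (\<Sum>j<K + a. digit B a j)"
    by (rule digit_sum_eq_sum[OF assms 2])
  also have "\<dots> = (\<Sum>j<K. digit B a j) + (\<Sum>j<a. digit B a (K + j))"
    by (rule sum_lessThan_plus)
  finally show ?thesis
    by (simp add: 3)
qed

lemma digit_sum_0 [simp]: "digit_sum B 0 = 0"
  by (simp add: digit_sum_def digit_def)

lemma digit_sum_le:
  assumes "B \<ge> 2"
  shows "digit_sum B a \<le> a"
proof -
  \<comment> \<open>Passing from \<open>K\<close> to \<open>Suc K\<close> splits a quotient
    \<open>d + B * r\<close> and keeps only \<open>d + r\<close>, so the left side never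
    grows.\<close>
  have "(\<Sum>j<K. digit B a j) + a div B ^ K \<le> a" for K
  proof (induction K)
    case (Suc K)
    have "a div B ^ Suc K \<le> B * (a div B ^ Suc K)"
      using assms by simp
    with Suc digit_decomp[of a B K] show ?case
      unfolding sum.lessThan_Suc by linarith
  qed simp
  from this[of a] show ?thesis
    using digit_sum_eq_sum[OF assms less_self_power[OF assms]] by simp
qed

section \<open>Carries and column relations\<close>

text \<open>A closed form for the carry: it is what the quotient of the total exceeds the quotients
  of the summands by. In the induction, the part of the summands beyond the current column is a
  multiple of \<open>B\<close> and leaves the division intact.\<close>

lemma sum_list_div_power:
  assumes "B > 0"
  shows "sum_list as div B ^ Suc j = carry B as j + (\<Sum>a\<leftarrow>as. a div B ^ Suc j)"
proof -
  have split: "(\<Sum>a\<leftarrow>as. a div B ^ j) =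
      (\<Sum>a\<leftarrow>as. digit B a j) + B * (\<Sum>a\<leftarrow>as. a div B ^ Suc j)" for j
    by (subst digit_decomp) (simp add: sum_list_addf sum_list_const_mult del: power_Suc)
  show ?thesis
  proof (induction j)
    case 0
    from split[of 0] assms show ?case by simp
  next
    case (Suc j)
    have "sum_list as div B ^ Suc (Suc j) = sum_list as div B ^ Suc j div B"
      by (simp add: div_mult2_eq[symmetric] mult.commute mult.left_commute)
    also have "\<dots> = ((\<Sum>a\<leftarrow>as. digit B a (Suc j)) + carry B as j
        + B * (\<Sum>a\<leftarrow>as. a div B ^ Suc (Suc j))) div B"
      unfolding Suc.IH by (subst split[of "Suc j"]) (simp add: ac_simps del: power_Suc)
    also have "\<dots> = carry B as (Suc j) + (\<Sum>a\<leftarrow>as. a div B ^ Suc (Suc j))"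
      using assms by (simp del: power_Suc)
    finally show ?case .
  qed
qed

text \<open>Expand the quotient of the total by \<open>B ^ Suc j\<close> in two ways, through the
  carry out of column \<open>j\<close> and through its own lowest digit; the quotients of the
  summands by \<open>B ^ Suc (Suc j)\<close> cancel.\<close>

lemma column_relation:
  assumes "B > 0"
  shows "(\<Sum>a\<leftarrow>as. digit B a (Suc j)) + carry B as j =
    B * carry B as (Suc j) + digit B (sum_list as) (Suc j)"
proof -
  have "(\<Sum>a\<leftarrow>as. a div B ^ Suc j) =
      (\<Sum>a\<leftarrow>as. digit B a (Suc j)) + B * (\<Sum>a\<leftarrow>as. a div B ^ Suc (Suc j))"
    by (subst digit_decomp) (simp add: sum_list_addf sum_list_const_mult del: power_Suc)
  moreover have "sum_list as div B ^ Suc j =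
      digit B (sum_list as) (Suc j) + B * (sum_list as div B ^ Suc (Suc j))"
    by (rule digit_decomp)
  ultimately show ?thesis
    unfolding sum_list_div_power[OF assms] by (simp add: distrib_left del: power_Suc carry.simps)
qed

lemma column_relation_0:
  assumes "B > 0"
  shows "(\<Sum>a\<leftarrow>as. digit B a 0) = B * carry B as 0 + digit B (sum_list as) 0"
proof -
  have "sum_list as = (\<Sum>a\<leftarrow>as. digit B a 0) + B * (\<Sum>a\<leftarrow>as. a div B)"
    by (induction as) (simp_all add: digit_def algebra_simps)
  moreover have "sum_list as =
      digit B (sum_list as) 0 + B * (carry B as 0 + (\<Sum>a\<leftarrow>as. a div B))"
    using digit_decomp[of "sum_list as" B 0] sum_list_div_power[OF assms, of as 0] by simp
  ultimately show ?thesis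
    by (simp add: distrib_left del: carry.simps)
qed

text \<open>Incoming carries lag one column behind outgoing ones. Adding \<open>carry B as J\<close>
  to both sides completes the incoming sum, which explains the isolated term.\<close>

lemma sum_column_relations:
  assumes "B > 0"
  shows "(\<Sum>j\<le>J. \<Sum>a\<leftarrow>as. digit B a j) + (\<Sum>j\<le>J. carry B as j) =
    B * (\<Sum>j\<le>J. carry B as j) + carry B as J + (\<Sum>j\<le>J. digit B (sum_list as) j)"
proof (induction J)
  case 0
  show ?case
    using column_relation_0[OF assms, of as] by (simp del: carry.simps)
next
  case (Suc J)
  with column_relation[OF assms, where as = as and j = J] show ?case
    by (simp add: distrib_left del: carry.simps)
qed

lemma less_power_top_position:
  assumes "B \<ge> 2" and "a \<in> set as"
  shows "a < B ^ Suc (top_position B as)"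
proof (cases "\<forall>a\<in>set as. a = 0")
  case True
  with assms(2) have "a = 0" by blast
  with assms(1) show ?thesis by simp
next
  case False
  define T where "T = Max {j. \<exists>a\<in>set as. digit B a j \<noteq> 0}"
  have "{j. \<exists>a\<in>set as. digit B a j \<noteq> 0} = (\<Union>a\<in>set as. {j. digit B a j \<noteq> 0})"
    by auto
  then have "finite {j. \<exists>a\<in>set as. digit B a j \<noteq> 0}"
    using finite_nonzero_digits[OF assms(1)] by simp
  then have zero: "digit B a j = 0" if "j > T" for j
    using that assms(2) Max_ge unfolding T_def by (metis (mono_tags, lifting) leD mem_Collect_eq)
  \<comment> \<open>Each vanishing digit above \<open>T\<close> makes \<open>digit_decomp\<close> a
    bare multiplication by \<open>B\<close>. For \<open>k = a\<close> the right side is zero because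
    \<open>a < B ^ a\<close>.\<close>
  have "a div B ^ Suc T = B ^ k * (a div B ^ (Suc T + k))" for k
  proof (induction k)
    case (Suc k)
    then show ?case
      using digit_decomp[of a B "Suc T + k"] zero[of "Suc T + k"] by (simp add: ac_simps)
  qed simp
  from this[of a] have "a div B ^ Suc T = B ^ a * (a div B ^ a div B ^ Suc T)"
    by (simp only: power_add div_mult2_eq mult.commute[of "B ^ Suc T"])
  then have "a div B ^ Suc T = 0"
    using less_self_power[OF assms(1), of a] by simp
  then have "a < B ^ Suc T"
    using assms(1) by (simp add: div_eq_0_iff del: power_Suc)
  with False show ?thesis
    by (simp only: top_position_def T_def if_False)
qed

text \<open>Beyond the top column the total has exactly the digits of the terminal carry \<beta>;
  the correction \<beta> - s(\<beta>) in \<open>c_hat\<close> accounts for them.\<close>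

lemma c_hat_eq:
  assumes "B \<ge> 2"
  shows "c_hat B as = (\<Sum>a\<leftarrow>as. int (digit_sum B a)) - int (digit_sum B (sum_list as))"
proof -
  define T where "T = top_position B as"
  define c where "c = (\<Sum>j\<le>T. carry B as j)"
  have B: "B > 0" using assms by simp
  have small: "a < B ^ Suc T" if "a \<in> set as" for a
    using less_power_top_position[OF assms that] by (simp add: T_def)
  have "(\<Sum>a\<leftarrow>as. a div B ^ Suc T) = (\<Sum>a\<leftarrow>as. 0)"
    using small by (intro arg_cong[where f = sum_list] map_cong) (auto simp del: power_Suc)
  then have "sum_list as div B ^ Suc T = carry B as T"
    using sum_list_div_power[OF B, of as T] by simp
  then have total: "digit_sum B (sum_list as) =
      (\<Sum>j\<le>T. digit B (sum_list as) j) + digit_sum B (carry B as T)"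
    using digit_sum_split[OF assms, of "sum_list as" "Suc T"] by (simp only: lessThan_Suc_atMost)
  have "(\<Sum>a\<leftarrow>as. digit_sum B a) = (\<Sum>a\<leftarrow>as. \<Sum>j\<le>T. digit B a j)"
    using digit_sum_eq_sum[OF assms small]
    by (intro arg_cong[where f = sum_list] map_cong) (auto simp only: lessThan_Suc_atMost)
  also have "\<dots> = (\<Sum>j\<le>T. \<Sum>a\<leftarrow>as. digit B a j)"
    by (induction as) (simp_all add: sum.distrib)
  finally have "(\<Sum>a\<leftarrow>as. digit_sum B a) + c =
      B * c + carry B as T + (\<Sum>j\<le>T. digit B (sum_list as) j)"
    using sum_column_relations[OF B, where as = as and J = T] by (simp add: c_def)
  with total have "(\<Sum>a\<leftarrow>as. digit_sum B a) + c + digit_sum B (carry B as T) =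
      B * c + carry B as T + digit_sum B (sum_list as)"
    by simp
  \<comment> \<open>The balance is kept free of subtraction until here, since subtraction on
    \<open>nat\<close> truncates.\<close>
  then have "int (\<Sum>a\<leftarrow>as. digit_sum B a) + int c + int (digit_sum B (carry B as T)) =
      int B * int c + int (carry B as T) + int (digit_sum B (sum_list as))"
    by (metis of_nat_add of_nat_mult)
  moreover have "(\<Sum>a\<leftarrow>as. int (digit_sum B a)) = int (\<Sum>a\<leftarrow>as. digit_sum B a)"
    by (induction as) simp_all
  moreover have "carry_sum B as = c"
    by (simp add: carry_sum_def c_def T_def atMost_atLeast0)
  ultimately show ?thesis
    by (simp add: c_hat_def terminal_carry_def T_def[symmetric] algebra_simps)
qed

section \<open>Equal summands and generating functions\<close>

lemma c_hat_replicate: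
  assumes "B \<ge> 2"
  shows "c_hat B (replicate n a) = int n * int (digit_sum B a) - int (digit_sum B (n * a))"
  by (simp add: c_hat_eq[OF assms] sum_list_replicate)

lemma c_hat_pair_eq_diff:
  assumes "B \<ge> 2"
  shows "c_hat B [a * n, a] = c_hat B (replicate (Suc n) a) - c_hat B (replicate n a)"
  unfolding c_hat_replicate[OF assms] c_hat_eq[OF assms, of "[a * n, a]"]
  by (simp add: algebra_simps)

text \<open>Both terms of the difference lie between 0 and \<open>n * a\<close>. Such linear growth
  is enough for convergence in the unit disc.\<close>

lemma abs_c_hat_replicate_le:
  assumes "B \<ge> 2"
  shows "\<bar>c_hat B (replicate n a)\<bar> \<le> int n * int a"
proof -
  have "int n * int (digit_sum B a) \<le> int n * int a"
    using digit_sum_le[OF assms] by (intro mult_left_mono) auto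
  moreover have "int (digit_sum B (n * a)) \<le> int n * int a"
    using digit_sum_le[OF assms, of "n * a"] by (metis of_nat_le_iff of_nat_mult)
  moreover have "0 \<le> int n * int (digit_sum B a)"
    by simp
  ultimately show ?thesis
    unfolding c_hat_replicate[OF assms] by linarith
qed

theorem theorem2p8:
  fixes B a :: nat and q :: complex
  assumes "B \<ge> 2" and "norm q < 1"
  shows "summable (\<lambda>n. of_int (c_hat B (replicate (Suc n) a)) * q ^ Suc n)
    \<and> summable (\<lambda>n. of_int (c_hat B [a * n, a]) * q ^ n)
    \<and> (\<Sum>n. of_int (c_hat B (replicate (Suc n) a)) * q ^ Suc n)
        = q / (1 - q) * (\<Sum>n. of_int (c_hat B [a * n, a]) * q ^ n)"
proof -
  define f :: "nat \<Rightarrow> complex" where "f n = of_int (c_hat B (replicate n a))" for n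
  \<comment> \<open>The empty sum has no carries; this zero term allows the index shift
    below.\<close>
  have f0: "f 0 = 0"
    by (simp add: f_def c_hat_eq[OF assms(1)])
  have g: "of_int (c_hat B [a * n, a]) = f (Suc n) - f n" for n
    by (simp only: f_def c_hat_pair_eq_diff[OF assms(1)] of_int_diff)
  have bound: "norm (f n) \<le> real n * real a" for n
  proof -
    have "norm (f n) = of_int \<bar>c_hat B (replicate n a)\<bar>"
      by (simp add: f_def)
    also have "\<dots> \<le> of_int (int n * int a)"
      using abs_c_hat_replicate_le[OF assms(1)] by (simp only: of_int_le_iff)
    finally show ?thesis by simp
  qed
  \<comment> \<open>The derivative of the geometric series serves as majorant.\<close>
  have "summable (\<lambda>n. of_nat (Suc n) * norm q ^ n)"
    using assms(2) by (intro sums_summable[OF geometric_deriv_sums]) simp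
  then have "summable (\<lambda>n. real a * (of_nat (Suc n) * norm q ^ n))"
    by (rule summable_mult)
  then have sum_f_Suc: "summable (\<lambda>n. f (Suc n) * q ^ n)"
  proof (rule summable_comparison_test')
    fix n
    have "norm (f (Suc n)) * norm q ^ n \<le> real (Suc n) * real a * norm q ^ n"
      by (intro mult_right_mono bound) simp
    then show "norm (f (Suc n) * q ^ n) \<le> real a * (of_nat (Suc n) * norm q ^ n)"
      by (simp add: norm_mult norm_power ac_simps)
  qed
  define F where "F = (\<Sum>n. f (Suc n) * q ^ n)"
  have F: "(\<lambda>n. f (Suc n) * q ^ n) sums F"
    unfolding F_def using sum_f_Suc by (rule summable_sums)
  then have qF: "(\<lambda>n. f (Suc n) * q ^ Suc n) sums (q * F)"
    using sums_mult[OF F, of q] by (simp add: ac_simps)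
  \<comment> \<open>Prepending the zero term keeps the sum, so subtracting this series from the one
    for \<open>F\<close> gives the differences \<open>f (Suc n) - f n\<close> as
    coefficients.\<close>
  then have "(\<lambda>n. f n * q ^ n) sums (q * F)"
    using sums_Suc_iff[of "\<lambda>n. f n * q ^ n" "q * F"] f0 by simp
  from sums_diff[OF F this]
  have G: "(\<lambda>n. of_int (c_hat B [a * n, a]) * q ^ n) sums ((1 - q) * F)"
    unfolding g by (simp only: left_diff_distrib mult_1)
  have "q \<noteq> 1"
    using assms(2) by auto
  then have "q * F = q / (1 - q) * ((1 - q) * F)"
    by simp
  with sums_summable[OF qF] sums_summable[OF G] show ?thesis
    unfolding sums_unique[OF qF] sums_unique[OF G] f_def by blast
qed

end
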